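(* Let $X\sim N(\mu,1)$ be a normal random variable with mean $\mu\in\mathbb R$ and variance $1$. (i) For $a>\mu$ and every integer $K\ge1$, \[ P(X>a)=\varphi(a-\mu)\Bigl[\sum_{k=0}^{K-1}\frac{(-1)^k(2k-1)!!}{(a-\mu)^{2k+1}}+r_K\Bigr], \] where the remainder $r_K$ (defined by this equation) satisfies \[ \operatorname{sgn} r_K=(-1)^K,\qquad |r_K|<\frac{(2K-1)!!}{(a-\mu)^{2K+1}}; \] so the partial sums bracket the tail (after multiplication by $\varphi(a-\mu)$, the sums with even $K$ are lower bounds and those with odd $K$ are upper bounds for $P(X>a)$). (ii) As $a\to\infty$, locally uniformly for $\mu$ in compact subsets of $\mathbb R$, with $\varphi(a-\mu)=\varphi(a)e^{a\mu-\mu^2/2}$, \[ P(X>a)\sim\varphi(a)\,e^{a\mu-\mu^2/2}\sum_{n=0}^\infty\frac{\mathrm{He}_n(\mu)}{a^{n+1}}. \]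
   Context: $\varphi(z)=(2\pi)^{-1/2}e^{-z^2/2}$ is the standard normal density; $(-1)!!=1$. $\mathrm{He}_n$ are the probabilists' Hermite polynomials, $e^{yz-z^2/2}=\sum_{n\ge0}\mathrm{He}_n(y)\frac{z^n}{n!}$. The relation $\sim$ in (ii) means: for every integer $N\ge0$, $\dfrac{P(X>a)}{\varphi(a)e^{a\mu-\mu^2/2}}=\sum_{n=0}^{N}\mathrm{He}_n(\mu)a^{-n-1}+o(a^{-N-1})$ as $a\to\infty$, with the $o$-term uniform for $\mu$ in each compact set. *)

theory Defs
  imports "HOL-Probability.Probability" "HOL-Computational_Algebra.Polynomial"
begin

text \<open>
  The double factorial takes an integer argument so that \<open>(-1)!! = 1\<close> can be written literally;
  the value 1 below \<open>-1\<close> is a dummy.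
\<close>

function double_fact :: "int \<Rightarrow> nat" where
  "double_fact n = (if n \<le> 0 then 1 else nat n * double_fact (n - 2))"
  by auto
termination by (relation "Wellfounded.measure nat") auto

declare double_fact.simps [simp del]

lemma double_fact_minus_one: "double_fact (-1) = 1"
  by (subst double_fact.simps) simp

lemma double_fact_odd_Suc: "double_fact (2 * int (Suc k) - 1) = (2 * k + 1) * double_fact (2 * int k - 1)"
  by (subst double_fact.simps) (simp add: nat_add_distrib nat_mult_distrib)

definition is_Hermite :: "(nat \<Rightarrow> real poly) \<Rightarrow> bool" where
  "is_Hermite H \<longleftrightarrow> (\<forall>y z. (\<lambda>n. poly (H n) y * (z ^ n / fact n)) sums exp (y * z - z\<^sup>2 / 2))"

text \<open>
  The definite description is justified by \<open>ex1_is_Hermite\<close> below.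
\<close>

definition Hermite :: "nat \<Rightarrow> real poly" where
  "Hermite = (THE H. is_Hermite H)"

lemma ex_is_Hermite: "\<exists>H. is_Hermite H"
proof -
  define c :: "nat \<Rightarrow> real" where "c m = (if even m then (-1/2)^(m div 2) / fact (m div 2) else 0)" for m
  define H :: "nat \<Rightarrow> real poly" where
    "H n = (\<Sum>i\<le>n. monom (fact n * c (n - i) / fact i) i)" for n
  have E: "(\<lambda>n. x ^ n / fact n) sums exp x" for x :: real
    using exp_converges[of x] by (simp add: scaleR_conv_of_real divide_inverse mult.commute)
  have Ea: "summable (\<lambda>n. norm (x ^ n / fact n))" for x :: real
    using summable_norm_exp[of x] by (simp add: divide_inverse mult.commute)
  have "(\<lambda>n. poly (H n) y * (z ^ n / fact n)) sums exp (y * z - z\<^sup>2 / 2)" for y z :: real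
  proof -
    define f where "f i = (y*z)^i / fact i" for i
    define g where "g i = c i * z^i" for i
    have f: "f sums exp (y*z)"
      unfolding f_def by (rule E)
    have fa: "summable (\<lambda>i. norm (f i))"
      unfolding f_def by (rule Ea)
    have sm: "strict_mono (\<lambda>n::nat. 2 * n)" by (auto simp: strict_mono_def)
    have g0: "g n = 0" if "n \<notin> range (\<lambda>n::nat. 2*n)" for n
      using that by (auto simp: g_def c_def elim!: evenE)
    have ge: "g (2*n) = (-(z\<^sup>2)/2)^n / fact n" for n
    proof -
      have "(-(z\<^sup>2)/2)^n = (-1/2)^n * (z\<^sup>2)^n" 
        by (subst power_mult_distrib[symmetric]) simp
      then show ?thesis by (simp add: g_def c_def power_mult)
    qed
    have "(\<lambda>n. g (2*n)) sums exp (-(z\<^sup>2)/2)"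
      unfolding ge by (rule E)
    then have g: "g sums exp (-(z\<^sup>2)/2)"
      by (subst (asm) sums_mono_reindex[OF sm g0])
    have "summable (\<lambda>n. norm (g (2*n)))"
      unfolding ge by (rule Ea)
    then have ga: "summable (\<lambda>i. norm (g i))"
      by (subst (asm) summable_mono_reindex[OF sm, of "\<lambda>i. norm (g i)"]) (use g0 in auto)
    have "(\<lambda>k. \<Sum>i\<le>k. f i * g (k - i)) sums ((\<Sum>k. f k) * (\<Sum>k. g k))"
      by (rule Cauchy_product_sums[OF fa ga])
    also have "(\<Sum>k. f k) * (\<Sum>k. g k) = exp (y * z - z\<^sup>2 / 2)"
      using f g by (simp add: sums_iff flip: exp_add)
    also have "(\<lambda>k. \<Sum>i\<le>k. f i * g (k - i)) = (\<lambda>n. poly (H n) y * (z ^ n / fact n))"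
    proof
      fix k
      have "z ^ i * z ^ (k - i) = z ^ k" if "i \<le> k" for i
        using that by (simp flip: power_add)
      then have "f i * g (k - i) = c (k - i) / fact i * y ^ i * z ^ k" if "i \<le> k" for i
        using that by (simp add: f_def g_def power_mult_distrib mult.assoc mult.left_commute)
      then show "(\<Sum>i\<le>k. f i * g (k - i)) = poly (H k) y * (z ^ k / fact k)"
        by (simp add: H_def poly_sum poly_monom sum_distrib_right sum_divide_distrib mult.assoc)
    qed
    finally show ?thesis .
  qed
  then show ?thesis unfolding is_Hermite_def by blast
qed

lemma is_Hermite_unique:
  assumes "is_Hermite H" "is_Hermite H'"
  shows "H = H'"
proof
  fix n
  have "poly (H n) y = poly (H' n) y" for y
  proof -
    define a where "a k = (poly (H k) y - poly (H' k) y) / fact k" for k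
    have s: "(\<lambda>k. a k * z ^ k) sums 0" for z
    proof -
      have "(\<lambda>k. poly (H k) y * (z ^ k / fact k) - poly (H' k) y * (z ^ k / fact k)) sums
              (exp (y * z - z\<^sup>2 / 2) - exp (y * z - z\<^sup>2 / 2))"
        using assms by (intro sums_diff) (auto simp: is_Hermite_def)
      then show ?thesis
        by (simp add: a_def diff_divide_distrib left_diff_distrib)
    qed
    have "a n = 0"
    proof (induction n rule: less_induct)
      case (less n)
      have "(\<lambda>k. a (k + n) * z ^ k) sums 0" if "z \<noteq> 0" for z
      proof -
        have "(\<lambda>k. a (k + n) * z ^ (k + n)) sums 0"
          using sums_zero_iff_shift[of n "\<lambda>k. a k * z ^ k" 0] less s by simp
        from sums_mult2[OF this, of "1 / z ^ n"] that show ?thesis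
          by (simp add: power_add)
      qed
      from powser_limit_0_strong[of 1 "\<lambda>k. a (k + n)" "\<lambda>_. 0", OF _ this]
      have "((\<lambda>_::real. 0) \<longlongrightarrow> a n) (at 0)" by simp
      then show ?case by (simp add: tendsto_const_iff)
    qed
    then show ?thesis by (simp add: a_def)
  qed
  then show "H n = H' n" by (simp add: poly_eq_poly_eq_iff[symmetric] fun_eq_iff)
qed

lemma ex1_is_Hermite: "\<exists>!H. is_Hermite H"
  using ex_is_Hermite is_Hermite_unique by blast

lemma is_Hermite_Hermite: "is_Hermite Hermite"
  unfolding Hermite_def by (rule theI'[OF ex1_is_Hermite])

end

theory Submission
  imports Defs
begin

text \<open>
  Write \<open>Q\<close> for the standard normal tail and \<open>\<phi>\<close> for the density, so that \<open>Q' = - \<phi>\<close> and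
  \<open>P(X > a) = Q (a - \<mu>)\<close>. For an approximation \<open>S\<close> of the Mills ratio \<open>Q / \<phi>\<close>, the difference
  \<open>Q - \<phi> S\<close> vanishes at infinity and has derivative \<open>\<phi> (x S - 1 - S')\<close>. For both partial sums
  the bracket telescopes to the last term or two, in the Hermite case because
  \<open>He\<^sub>n\<^sub>+\<^sub>1 = y He\<^sub>n - n He\<^sub>n\<^sub>-\<^sub>1\<close>. In (i) it therefore has a constant sign, which gives the sign of
  every remainder; the bound on \<open>r\<^sub>K\<close> follows by comparing the signs of \<open>r\<^sub>K\<close> and \<open>r\<^sub>K\<^sub>+\<^sub>1\<close>. In (ii)
  it is dominated by the derivative of \<open>2 B \<phi>(a - \<mu>) / a\<^bsup>N + 2\<^esup>\<close>, with a constant \<open>B\<close>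
  uniform for \<open>\<mu>\<close> in a compact set.
\<close>

section \<open>The standard normal density and its upper tail\<close>

lemma std_normal_density_DERIV [derivative_intros]:
  assumes "(f has_real_derivative f') (at x within A)"
  shows "((\<lambda>x. std_normal_density (f x)) has_real_derivative
           - f x * std_normal_density (f x) * f') (at x within A)"
  unfolding normal_density_def
  by (rule derivative_eq_intros assms refl | simp add: field_simps)+

lemma std_normal_density_at_top: "(std_normal_density \<longlongrightarrow> 0) at_top"
  unfolding normal_density_def by real_asymp

definition std_normal_tail :: "real \<Rightarrow> real" where
  "std_normal_tail x = measure std_normal_distribution {x<..}"

lemma std_normal_tail_at_top: "(std_normal_tail \<longlongrightarrow> 0) at_top"
proof -
  interpret real_distribution std_normal_distribution by (rule real_dist_normal_dist)
  have "std_normal_tail = (\<lambda>x. 1 - cdf std_normal_distribution x)"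
  proof
    fix x :: real
    have "UNIV - {..x} = {x<..}" by auto
    then show "std_normal_tail x = 1 - cdf std_normal_distribution x"
      using prob_compl[of "{..x}"] by (simp add: std_normal_tail_def cdf_def)
  qed
  moreover have "((\<lambda>x. 1 - cdf std_normal_distribution x) \<longlongrightarrow> 1 - 1) at_top"
    by (intro tendsto_intros cdf_lim_at_top_prob)
  ultimately show ?thesis by simp
qed

text \<open>Turns the tail, given as a measure, into an integral over a compact interval, where the
  fundamental theorem of calculus applies.\<close>

lemma std_normal_tail_diff:
  assumes "c \<le> y"
  shows "std_normal_tail y = std_normal_tail c - integral {c..y} std_normal_density"
proof -
  interpret real_distribution std_normal_distribution by (rule real_dist_normal_dist)
  have "{c<..} = {c<..y} \<union> {y<..}" using assms by auto
  then have "std_normal_tail c = measure std_normal_distribution {c<..y} + std_normal_tail y"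
    unfolding std_normal_tail_def by (simp add: finite_measure_Union ivl_disj_int)
  moreover have "measure std_normal_distribution {c<..y} = integral {c..y} std_normal_density"
  proof -
    have int: "set_integrable lborel {c<..y} std_normal_density"
      unfolding set_integrable_def by (intro integrable_mult_indicator) auto
    have "measure std_normal_distribution {c<..y} = (LINT x:{c<..y}|lborel. std_normal_density x)"
      unfolding set_lebesgue_integral_def
      using integral_density[of "indicator {c<..y} :: real \<Rightarrow> real" lborel std_normal_density]
      by (simp add: mult.commute normal_density_nonneg)
    also have "\<dots> = integral {c<..y} std_normal_density"
      using int by (rule set_borel_integral_eq_integral)
    also have "\<dots> = integral {c..y} std_normal_density"
      by (rule integral_spike_set; rule negligible_subset[of "{c}"]) auto
    finally show ?thesis .
  qed
  ultimately show ?thesis by simp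
qed

lemma std_normal_tail_DERIV [derivative_intros]:
  assumes "(f has_real_derivative f') (at x within A)"
  shows "((\<lambda>x. std_normal_tail (f x)) has_real_derivative - std_normal_density (f x) * f')
           (at x within A)"
proof (rule DERIV_chain2[OF _ assms])
  fix x :: real
  \<comment> \<open>Any base point below \<open>x\<close> would do: it puts \<open>x\<close> in the
    interior, so the derivative is two-sided and the integral formula holds near
    \<open>x\<close>.\<close>
  have "((\<lambda>y. integral {x - 1..y} std_normal_density) has_real_derivative std_normal_density x)
          (at x within {x - 1..x + 1})"
    by (rule integral_has_real_derivative)
       (auto intro!: continuous_intros simp: normal_density_def)
  then have der: "((\<lambda>y. std_normal_tail (x - 1) - integral {x - 1..y} std_normal_density)
               has_real_derivative - std_normal_density x) (at x)"
    by (subst (asm) at_within_interior) (auto intro!: derivative_eq_intros)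
  have ev: "\<forall>\<^sub>F y in nhds x. std_normal_tail (x - 1) - integral {x - 1..y} std_normal_density
                   = std_normal_tail y"
    using eventually_nhds_in_open[of "{x - 1<..}" x]
    by (auto elim!: eventually_mono intro!: std_normal_tail_diff[symmetric])
  from DERIV_cong_ev[OF refl ev refl] der
  show "(std_normal_tail has_real_derivative - std_normal_density x) (at x)"
    by (rule iffD1)
qed

text \<open>Standardizing \<open>X\<close> reduces everything to a function of one real
  variable.\<close>

lemma (in prob_space) prob_normal_greater:
  assumes "distributed M lborel X (normal_density \<mu> 1)"
  shows "\<P>(\<omega> in M. X \<omega> > a) = std_normal_tail (a - \<mu>)"
proof -
  have *: "distributed M lborel (\<lambda>\<omega>. X \<omega> - \<mu>) std_normal_density"
    using assms normal_standard_normal_convert[of 1 X \<mu>] by simp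
  then have [measurable]: "(\<lambda>\<omega>. X \<omega> - \<mu>) \<in> borel_measurable M"
    using distributed_measurable[OF *] by simp
  have "std_normal_tail (a - \<mu>) = measure (distr M lborel (\<lambda>\<omega>. X \<omega> - \<mu>)) {a - \<mu><..}"
    unfolding std_normal_tail_def distributed_distr_eq_density[OF *] ..
  also have "\<dots> = \<P>(\<omega> in M. X \<omega> > a)"
    by (subst measure_distr) (auto intro!: arg_cong[of _ _ "measure M"])
  finally show ?thesis ..
qed

lemma std_normal_density_diff:
  "std_normal_density (a - \<mu>) = std_normal_density a * exp (a * \<mu> - \<mu>\<^sup>2 / 2)"
  by (simp add: normal_density_def power2_eq_square field_simps flip: exp_add)

section \<open>Partial sums for the Mills ratio and the signs of their remainders\<close>

lemma double_fact_pos: "double_fact n > 0"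
proof (induction n rule: double_fact.induct)
  case (1 n)
  then show ?case by (subst double_fact.simps) simp
qed

definition mills_sum :: "nat \<Rightarrow> real \<Rightarrow> real" where
  "mills_sum K x = (\<Sum>k<K. (-1) ^ k * real (double_fact (2 * int k - 1)) / x ^ (2 * k + 1))"

lemma mills_sum_Suc:
  "mills_sum (Suc K) x =
     mills_sum K x + (-1) ^ K * real (double_fact (2 * int K - 1)) / x ^ (2 * K + 1)"
  by (simp add: mills_sum_def)

lemma divide_power_DERIV:
  fixes c x :: real
  assumes "x \<noteq> 0"
  shows "((\<lambda>x. c / x ^ (m + 1)) has_real_derivative - (real (m + 1) * c / x ^ (m + 2))) (at x)"
  by (rule derivative_eq_intros refl | use assms in \<open>simp add: field_simps\<close>)+

text \<open>The derivative of each term is \<open>x\<close> times the next term, because the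
  coefficients satisfy \<open>c (k + 1) = - (2 * k + 1) * c k\<close>. Hence the sum telescopes,
  leaving \<open>- 1\<close> from the first term and one term at index \<open>K\<close>.\<close>

lemma mills_sum_DERIV:
  assumes "x \<noteq> 0"
  shows "(mills_sum K has_real_derivative
           x * mills_sum K x - 1 + (-1) ^ K * real (double_fact (2 * int K - 1)) / x ^ (2 * K)) (at x)"
proof (induction K)
  case 0
  then show ?case
    by (simp add: mills_sum_def[abs_def] double_fact_minus_one)
next
  case (Suc K)
  let ?c = "(-1) ^ K * real (double_fact (2 * int K - 1))"
  have "((\<lambda>x. ?c / x ^ (2 * K + 1)) has_real_derivative
          - (real (2 * K + 1) * ?c / x ^ (2 * K + 2))) (at x)"
    using assms by (rule divide_power_DERIV)
  from DERIV_add[OF Suc this] show ?case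
    unfolding mills_sum_Suc[abs_def] double_fact_odd_Suc
    by (rule DERIV_cong) (use assms in \<open>simp add: field_simps\<close>)
qed

lemma mills_sum_at_top: "(mills_sum K \<longlongrightarrow> 0) at_top"
  unfolding mills_sum_def
  by (rule tendsto_null_sum) real_asymp

lemma mills_remainder_pos:
  assumes "x > 0"
  shows "(-1) ^ K * (std_normal_tail x - std_normal_density x * mills_sum K x) > 0"
proof -
  let ?f = "\<lambda>x. (-1) ^ K * (std_normal_tail x - std_normal_density x * mills_sum K x)"
  have lim: "(?f \<longlongrightarrow> 0) at_top"
    by (rule tendsto_eq_intros std_normal_tail_at_top std_normal_density_at_top mills_sum_at_top
        refl | simp)+
  have "\<exists>z. (?f has_real_derivative z) (at y) \<and> z < 0" if "y \<ge> x" for y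
  proof -
    from that assms have y: "y > 0" by simp
    define c :: real where "c = (-1) ^ K"
    define D where "D = real (double_fact (2 * int K - 1)) / y ^ (2 * K)"
    \<comment> \<open>The sign enters the derivative twice, as the outer factor and through the last
      term; its square being 1 makes the derivative negative for every \<open>K\<close>.\<close>
    have cc: "c * c = 1" by (simp add: c_def flip: power_mult_distrib)
    have S: "(mills_sum K has_real_derivative y * mills_sum K y - 1 + c * D) (at y)"
      using mills_sum_DERIV[of y K] y by (simp add: c_def D_def)
    have "((\<lambda>x. c * (std_normal_tail x - std_normal_density x * mills_sum K x)) has_real_derivative
            - (c * c) * (std_normal_density y * D)) (at y)"
      by (rule derivative_eq_intros S DERIV_ident refl)+ (simp add: algebra_simps)
    then have "(?f has_real_derivative - (std_normal_density y * D)) (at y)"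
      by (simp add: cc c_def)
    moreover have "- (std_normal_density y * D) < 0"
      using y by (simp add: D_def normal_density_pos double_fact_pos)
    ultimately show ?thesis by blast
  qed
  from DERIV_neg_imp_decreasing_at_top[of x ?f, OF this lim] show ?thesis .
qed

lemma mills_remainder:
  fixes x :: real and K :: nat
  defines "r \<equiv> std_normal_tail x / std_normal_density x - mills_sum K x"
  assumes "x > 0"
  shows "sgn r = (-1) ^ K" "\<bar>r\<bar> < real (double_fact (2 * int K - 1)) / x ^ (2 * K + 1)"
proof -
  have pos: "(-1) ^ K * (std_normal_tail x / std_normal_density x - mills_sum K x) > 0" for K
  proof -
    have "std_normal_density x > 0" by (simp add: normal_density_pos)
    then show ?thesis
      using mills_remainder_pos[OF assms(2), of K] by (simp add: zero_less_mult_iff field_simps)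
  qed
  have 1: "(-1) ^ K * r > 0" unfolding r_def by (rule pos)
  \<comment> \<open>The sign statement for \<open>Suc K\<close>, with the extra factor
    \<open>-1\<close> moved across: the remainder does not reach the first omitted term. With
    \<open>1\<close> it lies strictly between 0 and that term.\<close>
  have 2: "(-1) ^ K * (r - (-1) ^ K * real (double_fact (2 * int K - 1)) / x ^ (2 * K + 1)) < 0"
    using pos[of "Suc K"] by (simp add: mills_sum_Suc r_def algebra_simps)
  show "sgn r = (-1) ^ K" using 1 by (cases "even K") auto
  show "\<bar>r\<bar> < real (double_fact (2 * int K - 1)) / x ^ (2 * K + 1)"
    using 1 2 by (cases "even K") auto
qed

section \<open>The Hermite recurrence from the generating function\<close>

lemma power_series_coeff_eq_0:
  fixes a :: "nat \<Rightarrow> real"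
  assumes "\<And>z. (\<lambda>n. a n * z ^ n) sums 0"
  shows "a n = 0"
proof -
  \<comment> \<open>Adding the null series to the generating function reduces this to \<open>is_Hermite_unique\<close>.\<close>
  have "is_Hermite (\<lambda>n. Hermite n + [:fact n * a n:])"
    unfolding is_Hermite_def
  proof (intro allI)
    fix y z :: real
    show "(\<lambda>n. poly (Hermite n + [:fact n * a n:]) y * (z ^ n / fact n)) sums exp (y * z - z\<^sup>2 / 2)"
      using sums_add[OF is_Hermite_Hermite[unfolded is_Hermite_def, rule_format, of y z] assms[of z]]
      by (simp add: algebra_simps add_divide_distrib)
  qed
  from fun_cong[OF is_Hermite_unique[OF this is_Hermite_Hermite], of n] show ?thesis
    by simp
qed

lemma Hermite_sums: "(\<lambda>n. poly (Hermite n) y / fact n * z ^ n) sums exp (y * z - z\<^sup>2 / 2)"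
  using is_Hermite_Hermite by (simp add: is_Hermite_def)

lemma poly_Hermite_0: "poly (Hermite 0) y = 1"
  using sums_unique2[OF powser_sums_zero Hermite_sums[of y 0]] by simp

text \<open>The generating function \<open>G\<close> satisfies \<open>G' = (y - z) * G\<close> in
  \<open>z\<close>; comparing coefficients gives the recurrence. For \<open>n = 0\<close> the
  truncated index \<open>n - 1\<close> is harmless, as its factor vanishes.\<close>

lemma poly_Hermite_Suc:
  "poly (Hermite (Suc n)) y = y * poly (Hermite n) y - real n * poly (Hermite (n - 1)) y"
proof -
  define d where "d n = poly (Hermite n) y / fact n" for n
  \<comment> \<open>Coefficients of \<open>z * G\<close>: those of \<open>G\<close> shifted by one
    place, with 0 in front.\<close>
  define e where "e n = (case n of 0 \<Rightarrow> 0 | Suc m \<Rightarrow> d m)" for n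
  have d: "(\<lambda>n. d n * z ^ n) sums exp (y * z - z\<^sup>2 / 2)" for z
    unfolding d_def by (rule Hermite_sums)
  have "(\<lambda>n. (diffs d n - y * d n + e n) * z ^ n) sums 0" for z
  proof -
    have sm: "summable (\<lambda>n. d n * z ^ n)" for z using d by (rule sums_summable)
    have "((\<lambda>z. \<Sum>n. d n * z ^ n) has_real_derivative (\<Sum>n. diffs d n * z ^ n)) (at z)"
      using sm by (rule termdiffs_strong_converges_everywhere)
    moreover have "((\<lambda>z. \<Sum>n. d n * z ^ n) has_real_derivative (y - z) * exp (y * z - z\<^sup>2 / 2)) (at z)"
      unfolding sums_unique[OF d, symmetric] by (auto intro!: derivative_eq_intros)
    ultimately have "(\<Sum>n. diffs d n * z ^ n) = (y - z) * exp (y * z - z\<^sup>2 / 2)"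
      by (rule DERIV_unique)
    moreover have "summable (\<lambda>n. diffs d n * z ^ n)"
      using sm by (rule termdiff_converges_all)
    ultimately have "(\<lambda>n. diffs d n * z ^ n) sums ((y - z) * exp (y * z - z\<^sup>2 / 2))"
      by (simp add: sums_iff)
    moreover have "(\<lambda>n. e n * z ^ n) sums (z * exp (y * z - z\<^sup>2 / 2))"
    proof -
      have "(\<lambda>n. e (Suc n) * z ^ Suc n) sums (z * exp (y * z - z\<^sup>2 / 2))"
        using sums_mult[OF d[of z], of z] by (simp add: e_def mult_ac)
      from sums_Suc[OF this] show ?thesis by (simp add: e_def)
    qed
    ultimately have "(\<lambda>n. diffs d n * z ^ n - y * (d n * z ^ n) + e n * z ^ n) sums
        ((y - z) * exp (y * z - z\<^sup>2 / 2) - y * exp (y * z - z\<^sup>2 / 2) + z * exp (y * z - z\<^sup>2 / 2))"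
      by (intro sums_add sums_diff sums_mult d)
    then show ?thesis by (simp add: algebra_simps)
  qed
  then have "diffs d n - y * d n + e n = 0"
    by (rule power_series_coeff_eq_0)
  \<comment> \<open>Multiplying by \<open>fact n\<close> turns \<open>diffs d n\<close> into the
    polynomial of index \<open>n + 1\<close> and \<open>e n\<close> into \<open>n\<close> times that
    of index \<open>n - 1\<close>.\<close>
  then show ?thesis
    by (cases n) (auto simp: diffs_def d_def e_def field_simps simp del: of_nat_Suc)
qed

section \<open>Hermite partial sums and their uniform remainder bound\<close>

definition hermite_sum :: "nat \<Rightarrow> real \<Rightarrow> real \<Rightarrow> real" where
  "hermite_sum N \<mu> a = (\<Sum>n\<le>N. poly (Hermite n) \<mu> / a ^ (n + 1))"

lemma hermite_sum_Suc:
  "hermite_sum (Suc N) \<mu> a = hermite_sum N \<mu> a + poly (Hermite (Suc N)) \<mu> / a ^ (Suc N + 1)"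
  by (simp add: hermite_sum_def)

text \<open>In the induction step the coefficients of \<open>1 / a ^ (N + 2)\<close> cancel by the
  recurrence. As it links three consecutive polynomials, two boundary terms survive instead of
  one.\<close>

lemma hermite_sum_DERIV:
  assumes "a \<noteq> 0"
  shows "(hermite_sum N \<mu> has_real_derivative
           (a - \<mu>) * hermite_sum N \<mu> a - 1 + poly (Hermite (Suc N)) \<mu> / a ^ (N + 1)
             - real (N + 1) * poly (Hermite N) \<mu> / a ^ (N + 2)) (at a)"
proof (induction N)
  case 0
  have "hermite_sum 0 \<mu> = (\<lambda>a. 1 / a ^ (0 + 1))"
    by (simp add: hermite_sum_def poly_Hermite_0 fun_eq_iff)
  with divide_power_DERIV[OF assms, of 1 0] assms show ?case
    by (simp add: poly_Hermite_0 poly_Hermite_Suc field_simps power2_eq_square)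
next
  case (Suc N)
  let ?c = "poly (Hermite (Suc N)) \<mu>"
  have "((\<lambda>a. ?c / a ^ (Suc N + 1)) has_real_derivative - (real (N + 2) * ?c / a ^ (N + 3))) (at a)"
    using divide_power_DERIV[OF assms, of ?c "Suc N"] by (simp add: numeral_3_eq_3 add.commute)
  from DERIV_add[OF Suc this] show ?case
    unfolding hermite_sum_Suc[abs_def]
    by (rule DERIV_cong) (use assms in \<open>simp add: poly_Hermite_Suc[of "Suc N"] field_simps power_add eval_nat_numeral\<close>)
qed

lemma hermite_sum_at_top: "(hermite_sum N \<mu> \<longlongrightarrow> 0) at_top"
  unfolding hermite_sum_def
  by (rule tendsto_null_sum) real_asymp

text \<open>The majorant plus or minus the error decreases to 0, hence is positive; \<open>s\<close>
  covers both signs at once. \<open>B\<close> dominates the two boundary coefficients in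
  \<open>hermite_sum_DERIV\<close>.\<close>

lemma hermite_remainder_pos:
  fixes s :: real
  assumes B: "\<bar>poly (Hermite (Suc N)) \<mu>\<bar> + real (N + 1) * \<bar>poly (Hermite N) \<mu>\<bar> < B"
    and a: "a \<ge> 1" "a \<ge> 2 * \<mu>" and s: "\<bar>s\<bar> = 1"
  shows "2 * B * std_normal_density (a - \<mu>) / a ^ (N + 2)
           + s * (std_normal_tail (a - \<mu>) - std_normal_density (a - \<mu>) * hermite_sum N \<mu> a) > 0"
proof -
  let ?f = "\<lambda>a. 2 * B * std_normal_density (a - \<mu>) / a ^ (N + 2)
              + s * (std_normal_tail (a - \<mu>) - std_normal_density (a - \<mu>) * hermite_sum N \<mu> a)"
  have shift: "filterlim (\<lambda>a. a - \<mu>) at_top at_top" by real_asymp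
  have inv: "((\<lambda>a. 2 * B / a ^ (N + 2)) \<longlongrightarrow> 0) at_top" by real_asymp
  have "((\<lambda>a. std_normal_density (a - \<mu>) * (2 * B / a ^ (N + 2))
              + s * (std_normal_tail (a - \<mu>) - std_normal_density (a - \<mu>) * hermite_sum N \<mu> a))
          \<longlongrightarrow> 0 * 0 + s * (0 - 0 * 0)) at_top"
    by (intro tendsto_intros inv hermite_sum_at_top
        filterlim_compose[OF std_normal_tail_at_top shift]
        filterlim_compose[OF std_normal_density_at_top shift])
  then have lim: "(?f \<longlongrightarrow> 0) at_top" by (simp add: mult_ac)
  have "\<exists>z. (?f has_real_derivative z) (at x) \<and> z < 0" if "x \<ge> a" for x
  proof -
    from that a have x: "x \<ge> 1" "x \<ge> 2 * \<mu>" by auto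
    define \<phi> where "\<phi> = std_normal_density (x - \<mu>)"
    define h0 where "h0 = real (N + 1) * poly (Hermite N) \<mu>"
    define h1 where "h1 = poly (Hermite (Suc N)) \<mu>"
    \<comment> \<open>The derivative divided by the density: the first two summands come from the
      majorant, the last from the error.\<close>
    define D where "D = - (2 * B * (x - \<mu>) / x ^ (N + 2)) - 2 * B * (N + 2) / x ^ (N + 3)
                          + s * (h0 / x ^ (N + 2) - h1 / x ^ (N + 1))"
    have hB: "\<bar>h1\<bar> + \<bar>h0\<bar> < B" using B by (simp add: h0_def h1_def abs_mult add.commute)
    then have Bpos: "B > 0" by linarith
    define g where "g a = 2 * B / a ^ (N + 2)" for a
    have g: "(g has_real_derivative - (2 * B * (N + 2) / x ^ (N + 3))) (at x)"
      unfolding g_def using divide_power_DERIV[of x "2 * B" "N + 1"] x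
      by (simp add: mult_ac eval_nat_numeral)
    have h: "(hermite_sum N \<mu> has_real_derivative
               (x - \<mu>) * hermite_sum N \<mu> x - 1 + h1 / x ^ (N + 1) - h0 / x ^ (N + 2)) (at x)"
      using hermite_sum_DERIV[of x N \<mu>] x by (simp add: h0_def h1_def)
    have D: "D = - ((x - \<mu>) * g x) - 2 * B * (N + 2) / x ^ (N + 3)
               + s * (h0 / x ^ (N + 2) - h1 / x ^ (N + 1))"
      by (simp add: D_def g_def)
    have "((\<lambda>a. std_normal_density (a - \<mu>) * g a
                + s * (std_normal_tail (a - \<mu>) - std_normal_density (a - \<mu>) * hermite_sum N \<mu> a))
            has_real_derivative \<phi> * D) (at x)"
      by (rule derivative_eq_intros g h DERIV_ident refl)+ (simp add: D \<phi>_def algebra_simps)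
    then have "(?f has_real_derivative \<phi> * D) (at x)" by (simp add: g_def mult_ac)
    moreover have "D < 0"
    proof -
      have "s * (h0 / x ^ (N + 2) - h1 / x ^ (N + 1)) \<le> \<bar>h0 / x ^ (N + 2)\<bar> + \<bar>h1 / x ^ (N + 1)\<bar>"
        using s by (auto simp: abs_if split: if_splits)
      \<comment> \<open>\<open>x \<ge> 1\<close> brings both boundary terms to the same power of
        \<open>x\<close>.\<close>
      also have "\<bar>h0 / x ^ (N + 2)\<bar> \<le> \<bar>h0\<bar> / x ^ (N + 1)"
        using x by (auto simp: abs_divide intro!: divide_left_mono power_increasing)
      also have "\<bar>h1 / x ^ (N + 1)\<bar> = \<bar>h1\<bar> / x ^ (N + 1)"
        using x by (simp add: abs_divide)
      also have "\<bar>h0\<bar> / x ^ (N + 1) + \<bar>h1\<bar> / x ^ (N + 1) < B / x ^ (N + 1)"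
        using hB x by (simp add: add_divide_distrib[symmetric] divide_strict_right_mono)
      also have "\<dots> = B * x / x ^ (N + 2)"
        using x by (simp add: field_simps)
      \<comment> \<open>\<open>x \<ge> 2 * \<mu>\<close> means
        \<open>x \<le> 2 * (x - \<mu>)\<close>, whence the factor 2 in the majorant.\<close>
      also have "\<dots> \<le> 2 * B * (x - \<mu>) / x ^ (N + 2)"
        using x Bpos by (intro divide_right_mono) (auto simp: algebra_simps)
      finally have "s * (h0 / x ^ (N + 2) - h1 / x ^ (N + 1)) < 2 * B * (x - \<mu>) / x ^ (N + 2)" by simp
      moreover have "2 * B * (N + 2) / x ^ (N + 3) > 0"
        using x Bpos by (intro divide_pos_pos mult_pos_pos) auto
      ultimately show ?thesis unfolding D_def by linarith
  qed
  moreover have "\<phi> > 0" by (simp add: \<phi>_def normal_density_pos)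
  ultimately show ?thesis
    by (blast intro: mult_pos_neg)
  qed
  from DERIV_neg_imp_decreasing_at_top[of a ?f, OF this lim] show ?thesis .
qed

lemma hermite_remainder_bound:
  assumes "\<bar>poly (Hermite (Suc N)) \<mu>\<bar> + real (N + 1) * \<bar>poly (Hermite N) \<mu>\<bar> < B"
    and "a \<ge> 1" "a \<ge> 2 * \<mu>"
  shows "\<bar>std_normal_tail (a - \<mu>) / std_normal_density (a - \<mu>) - hermite_sum N \<mu> a\<bar>
           < 2 * B / a ^ (N + 2)"
proof -
  let ?q = "std_normal_tail (a - \<mu>)" and ?p = "std_normal_density (a - \<mu>)"
  have p: "?p > 0" by (simp add: normal_density_pos)
  have "?p * (2 * B / a ^ (N + 2) + s * (?q / ?p - hermite_sum N \<mu> a)) > 0" if "\<bar>s\<bar> = 1" for s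
    using hermite_remainder_pos[OF assms that] p by (simp add: algebra_simps)
  then have "2 * B / a ^ (N + 2) + s * (?q / ?p - hermite_sum N \<mu> a) > 0" if "\<bar>s\<bar> = 1" for s
    using that p by (simp only: zero_less_mult_iff) auto
  from this[of 1] this[of "-1"] show ?thesis by (simp add: abs_less_iff)
qed

text \<open>The bound \<open>2 * B / a ^ (N + 2)\<close> is one power better than needed: after
  scaling, \<open>2 * B / a\<close> remains, and by compactness one \<open>B\<close> serves all of
  \<open>C\<close>.\<close>

lemma hermite_uniform_limit:
  fixes C :: "real set"
  assumes "compact C"
  shows "uniform_limit C
           (\<lambda>a \<mu>. (std_normal_tail (a - \<mu>) / std_normal_density (a - \<mu>) - hermite_sum N \<mu> a)
                    / (1 / a ^ (N + 1)))
           (\<lambda>\<mu>. 0) at_top"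
proof (rule uniform_limitI)
  fix e :: real assume e: "e > 0"
  let ?b = "\<lambda>\<mu>. \<bar>poly (Hermite (Suc N)) \<mu>\<bar> + real (N + 1) * \<bar>poly (Hermite N) \<mu>\<bar>"
  have "compact (?b ` C)"
    using assms by (intro compact_continuous_image continuous_intros)
  then obtain B where B: "\<And>\<mu>. \<mu> \<in> C \<Longrightarrow> ?b \<mu> < B"
    using bounded_pos_less[of "?b ` C"] compact_imp_bounded by fastforce
  obtain m where m: "\<And>\<mu>. \<mu> \<in> C \<Longrightarrow> \<bar>\<mu>\<bar> < m"
    using bounded_pos_less[of C] compact_imp_bounded[OF assms] by auto
  show "\<forall>\<^sub>F a in at_top. \<forall>\<mu>\<in>C.
          dist ((std_normal_tail (a - \<mu>) / std_normal_density (a - \<mu>) - hermite_sum N \<mu> a)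
                / (1 / a ^ (N + 1))) 0 < e"
    \<comment> \<open>The first two thresholds supply the hypotheses of
      \<open>hermite_remainder_bound\<close>; the third makes \<open>2 * B / a\<close> at most
      \<open>e\<close>.\<close>
    using eventually_ge_at_top[of 1] eventually_ge_at_top[of "2 * m"]
      eventually_ge_at_top[of "2 * B / e"]
  proof eventually_elim
    case (elim a)
    show ?case
    proof
      fix \<mu> assume \<mu>: "\<mu> \<in> C"
      let ?d = "std_normal_tail (a - \<mu>) / std_normal_density (a - \<mu>) - hermite_sum N \<mu> a"
      have "\<bar>?d\<bar> * a ^ (N + 1) < 2 * B / a ^ (N + 2) * a ^ (N + 1)"
        using m[OF \<mu>] elim by (intro mult_strict_right_mono hermite_remainder_bound B[OF \<mu>]) auto
      also have "\<dots> = 2 * B / a" using elim by simp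
      also have "\<dots> \<le> e" using elim e by (simp add: field_simps)
      finally show "dist (?d / (1 / a ^ (N + 1))) 0 < e"
        using elim by (simp add: dist_real_def abs_mult)
    qed
  qed
qed

text \<open>Space and variable are indexed by the mean so that uniformity in \<mu> can be expressed;
  the o-term becomes uniform convergence to 0 of the error over
  \<open>1 / a ^ (N + 1)\<close>.\<close>

theorem theorem4p1:
  fixes M :: "real \<Rightarrow> 'a measure" and X :: "real \<Rightarrow> 'a \<Rightarrow> real"
  assumes prob: "\<And>\<mu>. prob_space (M \<mu>)"
    and normal: "\<And>\<mu>. distributed (M \<mu>) lborel (X \<mu>) (normal_density \<mu> 1)"
  shows
    "(\<forall>\<mu> a :: real. \<forall>K :: nat. a > \<mu> \<and> K \<ge> 1 \<longrightarrow>
        (\<exists>r :: real.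
            \<P>(\<omega> in M \<mu>. X \<mu> \<omega> > a) =
              std_normal_density (a - \<mu>) *
                ((\<Sum>k<K. (-1) ^ k * real (double_fact (2 * int k - 1)) / (a - \<mu>) ^ (2 * k + 1)) + r) \<and>
            sgn r = (-1) ^ K \<and>
            \<bar>r\<bar> < real (double_fact (2 * int K - 1)) / (a - \<mu>) ^ (2 * K + 1)) \<and>
        (even K \<longrightarrow>
            std_normal_density (a - \<mu>) *
              (\<Sum>k<K. (-1) ^ k * real (double_fact (2 * int k - 1)) / (a - \<mu>) ^ (2 * k + 1))
            < \<P>(\<omega> in M \<mu>. X \<mu> \<omega> > a)) \<and>
        (odd K \<longrightarrow>
            \<P>(\<omega> in M \<mu>. X \<mu> \<omega> > a)
            < std_normal_density (a - \<mu>) *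
              (\<Sum>k<K. (-1) ^ k * real (double_fact (2 * int k - 1)) / (a - \<mu>) ^ (2 * k + 1))))
     \<and>
     (\<forall>\<mu> a :: real. std_normal_density (a - \<mu>) = std_normal_density a * exp (a * \<mu> - \<mu>\<^sup>2 / 2))
     \<and>
     (\<forall>C :: real set. compact C \<longrightarrow> (\<forall>N :: nat.
        uniform_limit C
          (\<lambda>a \<mu>. (\<P>(\<omega> in M \<mu>. X \<mu> \<omega> > a) / (std_normal_density a * exp (a * \<mu> - \<mu>\<^sup>2 / 2))
                   - (\<Sum>n\<le>N. poly (Hermite n) \<mu> / a ^ (n + 1))) / (1 / a ^ (N + 1)))
          (\<lambda>\<mu>. 0) at_top))"
proof -
  have P: "\<P>(\<omega> in M \<mu>. X \<mu> \<omega> > a) = std_normal_tail (a - \<mu>)" for \<mu> a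
    using prob_space.prob_normal_greater[OF prob normal] .
  show ?thesis
    unfolding P std_normal_density_diff[symmetric] mills_sum_def[symmetric] hermite_sum_def[symmetric]
  \<comment> \<open>After the folding, \<open>refl\<close> closes the density identity and
    \<open>hermite_uniform_limit\<close> the expansion in (ii); only the claims of (i)
    remain.\<close>
  proof (intro conjI allI impI hermite_uniform_limit refl)
    fix \<mu> a :: real and K :: nat
    assume "a > \<mu> \<and> K \<ge> 1"
    then have x: "a - \<mu> > 0" by simp
    have p: "std_normal_density (a - \<mu>) > 0" by (simp add: normal_density_pos)
    let ?r = "std_normal_tail (a - \<mu>) / std_normal_density (a - \<mu>) - mills_sum K (a - \<mu>)"
    show "\<exists>r. std_normal_tail (a - \<mu>) = std_normal_density (a - \<mu>) * (mills_sum K (a - \<mu>) + r) \<and>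
            sgn r = (-1) ^ K \<and> \<bar>r\<bar> < real (double_fact (2 * int K - 1)) / (a - \<mu>) ^ (2 * K + 1)"
      by (rule exI[of _ ?r]) (use p mills_remainder[OF x, of K] in simp)
    show "std_normal_density (a - \<mu>) * mills_sum K (a - \<mu>) < std_normal_tail (a - \<mu>)" if "even K"
      using mills_remainder_pos[OF x, of K] that by simp
    show "std_normal_tail (a - \<mu>) < std_normal_density (a - \<mu>) * mills_sum K (a - \<mu>)" if "odd K"
      using mills_remainder_pos[OF x, of K] that by simp
  qed
qed

end
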